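(* Let $3 \leq m \leq n$, and suppose $\mathcal{B}$ is a cycle $M$-basis for the complete bipartite graph $K_{m,n}$. Then at least one element of $\mathcal{B}$ has more than $4$ nonzero entries (so that at least one of the cycles is not a $4$-cycle).
   Context: Let $G=(V,E)$ be a finite connected undirected simple graph with a fixed orientation of its edges, and let $\partial : \mathbb{R}^E \to \mathbb{R}^V$ be the signed incidence matrix: the column of an edge has an entry $-1$ in the row of one endpoint and $+1$ in the row of the other endpoint (according to the orientation), and $0$ elsewhere. The lattice of integral flows of $G$ is $\mathcal{F}(G) = \mathbb{Z}^E \cap \ker(\partial)$, a free abelian group of rank $g = |E|-|V|+1$. Given a $\mathbb{Z}$-basis $\mathcal{B} = \{\mathbf{f}_1,\dots,\mathbf{f}_g\}$ of $\mathcal{F}(G)$, let $\iota$ be the $|E|\times g$ matrix with columns $\mathbf{f}_1,\dots,\mathbf{f}_g$; the associated dual Laplacian is $\mathcal{L}^* = \iota^T\iota$. A square matrix $L$ is a $Z$-matrix if $L_{ij}\le 0$ for all $i\ne j$. A $Z$-matrix $L$ is a (non-singular) $M$-matrix if all eigenvalues of $L$ have positive real part (equivalently, $L^{-1}$ exists and has all entries non-negative). $\mathcal{B}$ is an integral flow $M$-basis if $\mathcal{L}^*$ is an $M$-matrix. A cycle $M$-basis for $G$ is an integral flow $M$-basis each of whose elements encodes a directed (simple) cycle of $G$: all entries are in $\{0,1,-1\}$, the nonzero entries are exactly those at the edges of some simple cycle of $G$, and the signs are determined by comparing a cyclic orientation of that cycle with the fixed orientation of $G$ ($+1$ if they agree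 on the edge, $-1$ if they disagree). *)

theory Defs
  imports
    "Graph_Theory.Graph_Theory"
    "Jordan_Normal_Form.Char_Poly"
    "HOL-Library.Function_Algebras"
    Complex_Main
begin

section \<open>Graphs and orientations\<close>

text \<open>
  As in Graph_Theory, an undirected simple graph \<open>G\<close> is a symmetric loop-free digraph: each
  undirected edge is a pair of opposite arcs. An orientation is a set \<open>A\<close> of arcs containing exactly
  one arc of each pair, and serves as the edge set \<open>E\<close>. Elements of \<open>\<real>\<^sup>E\<close> are functions on pairs of
  vertices that vanish outside \<open>A\<close>.
\<close>

definition orientation :: "'v pair_pre_digraph \<Rightarrow> ('v \<times> 'v) set \<Rightarrow> bool" where
  "orientation G A \<longleftrightarrow>
     A \<subseteq> parcs G \<and> (\<forall>(u, v) \<in> parcs G. (u, v) \<in> A \<longleftrightarrow> (v, u) \<notin> A)"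

definition incidence :: "'v \<Rightarrow> 'v \<times> 'v \<Rightarrow> real" where
  "incidence v e = (if v = fst e then -1 else if v = snd e then 1 else 0)"

definition boundary :: "('v \<times> 'v) set \<Rightarrow> ('v \<times> 'v \<Rightarrow> real) \<Rightarrow> 'v \<Rightarrow> real" where
  "boundary A f v = (\<Sum>e\<in>A. incidence v e * f e)"


section \<open>The lattice of integral flows and its bases\<close>

definition integral_flows ::
    "'v pair_pre_digraph \<Rightarrow> ('v \<times> 'v) set \<Rightarrow> ('v \<times> 'v \<Rightarrow> real) set" where
  "integral_flows G A =
     {f. (\<forall>e\<in>A. f e \<in> \<int>) \<and> (\<forall>e. e \<notin> A \<longrightarrow> f e = 0) \<and> (\<forall>v\<in>pverts G. boundary A f v = 0)}"

definition int_scale :: "int \<Rightarrow> ('e \<Rightarrow> real) \<Rightarrow> 'e \<Rightarrow> real" where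
  "int_scale k f = (\<lambda>e. of_int k * f e)"

global_interpretation int_module: Modules.module "int_scale :: int \<Rightarrow> ('e \<Rightarrow> real) \<Rightarrow> 'e \<Rightarrow> real"
  by unfold_locales (auto simp: int_scale_def fun_eq_iff algebra_simps)

text \<open>Bases are ordered, since the elements index the rows and columns of the dual Laplacian.\<close>

definition integral_flow_basis ::
    "'v pair_pre_digraph \<Rightarrow> ('v \<times> 'v) set \<Rightarrow> ('v \<times> 'v \<Rightarrow> real) list \<Rightarrow> bool" where
  "integral_flow_basis G A B \<longleftrightarrow>
     distinct B \<and> int_module.independent (set B) \<and> int_module.span (set B) = integral_flows G A"

text \<open>
  With \<open>\<iota>\<close> the matrix whose rows are indexed by the edges \<open>e \<in> A\<close> and whose \<open>j\<close>-th column is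
  \<open>B ! j\<close>, the entries below are those of \<open>\<iota>\<^sup>T \<iota>\<close>.
\<close>

definition dual_laplacian :: "('v \<times> 'v) set \<Rightarrow> ('v \<times> 'v \<Rightarrow> real) list \<Rightarrow> real mat" where
  "dual_laplacian A B =
     mat (length B) (length B) (\<lambda>(i, j). \<Sum>e\<in>A. (B ! i) e * (B ! j) e)"


section \<open>M-matrices and M-bases\<close>

definition Z_matrix :: "real mat \<Rightarrow> bool" where
  "Z_matrix L \<longleftrightarrow>
     square_mat L \<and> (\<forall>i<dim_row L. \<forall>j<dim_col L. i \<noteq> j \<longrightarrow> L $$ (i, j) \<le> 0)"

definition M_matrix :: "real mat \<Rightarrow> bool" where
  "M_matrix L \<longleftrightarrow>
     Z_matrix L \<and> (\<forall>z. eigenvalue (map_mat complex_of_real L) z \<longrightarrow> Re z > 0)"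

definition integral_flow_M_basis ::
    "'v pair_pre_digraph \<Rightarrow> ('v \<times> 'v) set \<Rightarrow> ('v \<times> 'v \<Rightarrow> real) list \<Rightarrow> bool" where
  "integral_flow_M_basis G A B \<longleftrightarrow> integral_flow_basis G A B \<and> M_matrix (dual_laplacian A B)"

text \<open>
  In a symmetric digraph \<open>pre_digraph.cycle\<close> also admits the closed walks \<open>u, v, u\<close> of length 2,
  which are not cycles of the undirected graph; hence the bound on the length.
\<close>

definition simple_cycle :: "'v pair_pre_digraph \<Rightarrow> ('v \<times> 'v) list \<Rightarrow> bool" where
  "simple_cycle G p \<longleftrightarrow> pre_digraph.cycle (with_proj G) p \<and> 3 \<le> length p"

definition cycle_vector :: "('v \<times> 'v) set \<Rightarrow> ('v \<times> 'v) list \<Rightarrow> 'v \<times> 'v \<Rightarrow> real" where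
  "cycle_vector A p e =
     (if e \<in> A \<and> e \<in> set p then 1
      else if e \<in> A \<and> prod.swap e \<in> set p then -1
      else 0)"

definition cycle_M_basis ::
    "'v pair_pre_digraph \<Rightarrow> ('v \<times> 'v) set \<Rightarrow> ('v \<times> 'v \<Rightarrow> real) list \<Rightarrow> bool" where
  "cycle_M_basis G A B \<longleftrightarrow>
     integral_flow_M_basis G A B \<and> (\<forall>f\<in>set B. \<exists>p. simple_cycle G p \<and> f = cycle_vector A p)"

end

theory Submission
  imports Defs
begin

text \<open>
  Directing all edges from one side to the other turns flows on \<open>K\<^bsub>m,n\<^esub>\<close> into \<open>m \<times> n\<close> matrices with
  zero row and column sums; the 4-cycles are the matrices
  \<open>\<plusminus>(e\<^sub>i - e\<^sub>j) \<otimes> (e\<^sub>k - e\<^sub>l)\<close>. Two distinct 4-cycles with the same sign at an edge have positive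
  inner product, so in a basis of 4-cycles with non-positive inner products every edge occurs at most
  once with each sign. The basis has at least \<open>(m - 1)(n - 1)\<close> elements, hence at least
  \<open>4(m - 1)(n - 1)\<close> of the \<open>2mn\<close> signed edges are used, and since \<open>(m - 2)(n - 2) \<ge> 1\<close> at most two are
  left over. The sum of the basis vanishes at an edge used with both signs, so it is a flow with at
  most two nonzero entries. Therefore it is \<open>0\<close>, contradicting linear independence.
\<close>

section \<open>Matrices with zero line sums\<close>

definition zero_line_sums :: "'a set \<Rightarrow> 'b set \<Rightarrow> ('a \<Rightarrow> 'b \<Rightarrow> real) \<Rightarrow> bool" where
  "zero_line_sums U V X \<longleftrightarrow> (\<forall>u\<in>U. (\<Sum>v\<in>V. X u v) = 0) \<and> (\<forall>v\<in>V. (\<Sum>u\<in>U. X u v) = 0)"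

text \<open>This is e_i - e_j, a root of type A for i and j distinct. The tensor product of two such
  roots is the matrix of a directed 4-cycle.\<close>

definition root_vec :: "'a \<Rightarrow> 'a \<Rightarrow> 'a \<Rightarrow> real" where
  "root_vec i j u = of_bool (u = i) - of_bool (u = j)"

lemma sum_root_vec:
  assumes "finite U" "i \<in> U" "j \<in> U"
  shows "(\<Sum>u\<in>U. root_vec i j u) = 0"
  using assms by (simp add: root_vec_def sum_subtractf of_bool_def)

lemma zero_line_sums_root_vec:
  assumes "finite U" "finite V" "i \<in> U" "j \<in> U" "k \<in> V" "l \<in> V"
  shows "zero_line_sums U V (\<lambda>u v. root_vec i j u * root_vec k l v)"
  using assms unfolding zero_line_sums_def
  by (auto simp flip: sum_distrib_left sum_distrib_right simp: sum_root_vec)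

lemma sum_zero_another_nonzero:
  fixes f :: "'a \<Rightarrow> real"
  assumes "finite V" "(\<Sum>v\<in>V. f v) = 0" "k \<in> V" "f k \<noteq> 0"
  obtains l where "l \<in> V" "l \<noteq> k" "f l \<noteq> 0"
proof -
  have "(\<Sum>v\<in>V - {k}. f v) = - f k"
    using assms by (simp add: sum_diff1)
  then have "\<exists>l\<in>V - {k}. f l \<noteq> 0"
    using assms(4) by (metis neg_equal_0_iff_equal sum.neutral)
  then show thesis using that by blast
qed

text \<open>Vanishing line sums force a second nonzero entry in every line that has one. Following
  lines from (i, k) gives five distinct positions unless the walk closes up to a rectangle, and on a
  rectangle the sums fix the entries up to the common factor \<open>X i k\<close>.\<close>

lemma root_vec_tensor_if_small_support:
  assumes fin: "finite U" "finite V"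
    and X: "zero_line_sums U V X"
    and small: "card {(u, v) \<in> U \<times> V. X u v \<noteq> 0} \<le> 4"
    and ik: "i \<in> U" "k \<in> V" "X i k \<noteq> 0"
  obtains j l where "j \<in> U" "l \<in> V" "j \<noteq> i" "l \<noteq> k"
    "\<And>u v. u \<in> U \<Longrightarrow> v \<in> V \<Longrightarrow> X u v = X i k * root_vec i j u * root_vec k l v"
proof -
  let ?S = "{(u, v) \<in> U \<times> V. X u v \<noteq> 0}"
  have finS: "finite ?S"
    by (rule finite_subset[of _ "U \<times> V"]) (use fin in auto)
  have row: "(\<Sum>v\<in>V. X u v) = 0" if "u \<in> U" for u
    using X that by (auto simp: zero_line_sums_def)
  have col: "(\<Sum>u\<in>U. X u v) = 0" if "v \<in> V" for v
    using X that by (auto simp: zero_line_sums_def)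
  obtain l where l: "l \<in> V" "l \<noteq> k" "X i l \<noteq> 0"
    using sum_zero_another_nonzero[OF fin(2) row[OF ik(1)] ik(2,3)] by blast
  obtain j where j: "j \<in> U" "j \<noteq> i" "X j k \<noteq> 0"
    using sum_zero_another_nonzero[OF fin(1) col[OF ik(2)] ik(1,3)] by blast
  obtain l' where l': "l' \<in> V" "l' \<noteq> k" "X j l' \<noteq> 0"
    using sum_zero_another_nonzero[OF fin(2) row[OF j(1)] ik(2) j(3)] by blast
  obtain j' where j': "j' \<in> U" "j' \<noteq> i" "X j' l \<noteq> 0"
    using sum_zero_another_nonzero[OF fin(1) col[OF l(1)] ik(1) l(3)] by blast
  \<comment> \<open>The last two of the five positions coincide only if both equations hold; all
    other pairs differ by the choice of the lines.\<close>
  have eq: "j' = j \<and> l' = l"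
  proof (rule ccontr)
    assume "\<not> (j' = j \<and> l' = l)"
    then have five: "card {(i, k), (i, l), (j, k), (j, l'), (j', l)} = 5"
      using l j l' j' by (auto simp: card_insert_if)
    have "card {(i, k), (i, l), (j, k), (j, l'), (j', l)} \<le> card ?S"
      by (rule card_mono[OF finS]) (use l j l' j' ik in auto)
    then show False using small five by linarith
  qed
  have "{(i, k), (i, l), (j, k), (j, l)} = ?S"
  proof (rule card_seteq[OF finS])
    show "{(i, k), (i, l), (j, k), (j, l)} \<subseteq> ?S"
      using l j l' j' ik eq by auto
    have "card {(i, k), (i, l), (j, k), (j, l)} = 4"
      using l j by (auto simp: card_insert_if)
    then show "card ?S \<le> card {(i, k), (i, l), (j, k), (j, l)}"
      using small by simp
  qed
  then have zero: "X u v = 0"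
    if "u \<in> U" "v \<in> V" "(u, v) \<notin> {(i, k), (i, l), (j, k), (j, l)}" for u v
    using that by blast
  have row2: "X u k + X u l = 0" if "u \<in> U" for u
  proof -
    have "(\<Sum>v\<in>{k, l}. X u v) = (\<Sum>v\<in>V. X u v)"
      by (rule sum.mono_neutral_left) (use fin ik l that zero in auto)
    then show ?thesis using l row[OF that] by simp
  qed
  have col2: "X i v + X j v = 0" if "v \<in> V" for v
  proof -
    have "(\<Sum>u\<in>{i, j}. X u v) = (\<Sum>u\<in>U. X u v)"
      by (rule sum.mono_neutral_left) (use fin ik j that zero in auto)
    then show ?thesis using j col[OF that] by simp
  qed
  have "X i l = - X i k" "X j k = - X i k" "X j l = X i k"
    using row2[OF ik(1)] row2[OF j(1)] col2[OF ik(2)] col2[OF l(1)] by linarith+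
  then have "X u v = X i k * root_vec i j u * root_vec k l v" if "u \<in> U" "v \<in> V" for u v
    using zero[OF that] j(2) l(2) by (auto simp: root_vec_def)
  then show thesis using that l j by blast
qed

text \<open>A support of fewer than four positions would also be one of at most four, hence a
  rectangle, which has exactly four.\<close>

lemma card_support_ge_4:
  assumes fin: "finite U" "finite V"
    and X: "zero_line_sums U V X"
    and ik: "i \<in> U" "k \<in> V" "X i k \<noteq> 0"
  shows "card {(u, v) \<in> U \<times> V. X u v \<noteq> 0} \<ge> 4"
proof (rule ccontr)
  let ?S = "{(u, v) \<in> U \<times> V. X u v \<noteq> 0}"
  assume a: "\<not> 4 \<le> card ?S"
  then have "card ?S \<le> 4" by simp
  then obtain j l where jl: "j \<in> U" "l \<in> V" "j \<noteq> i" "l \<noteq> k"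
    "\<And>u v. u \<in> U \<Longrightarrow> v \<in> V \<Longrightarrow> X u v = X i k * root_vec i j u * root_vec k l v"
    using root_vec_tensor_if_small_support[OF fin X _ ik] by blast
  have "card {(i, k), (i, l), (j, k), (j, l)} = 4"
    using jl by (auto simp: card_insert_if)
  moreover have "{(i, k), (i, l), (j, k), (j, l)} \<subseteq> ?S"
    using jl(1-4) ik by (auto simp: jl(5)[of i l] jl(5)[of j k] jl(5)[of j l] root_vec_def)
  moreover have "finite ?S"
    by (rule finite_subset[of _ "U \<times> V"]) (use fin in auto)
  ultimately show False
    using card_mono[of ?S "{(i, k), (i, l), (j, k), (j, l)}"] a by linarith
qed

text \<open>Two directed 4-cycles that traverse an edge in the same direction cannot share another edge
  in opposite directions.\<close>

lemma inner_product_pos_if_agree: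
  assumes fin: "finite U" "finite V"
    and X: "zero_line_sums U V X" "card {(u, v) \<in> U \<times> V. X u v \<noteq> 0} \<le> 4"
    and Y: "zero_line_sums U V Y" "card {(u, v) \<in> U \<times> V. Y u v \<noteq> 0} \<le> 4"
    and ik: "i \<in> U" "k \<in> V" "X i k * Y i k > 0"
  shows "(\<Sum>u\<in>U. \<Sum>v\<in>V. X u v * Y u v) > 0"
proof -
  have nz: "X i k \<noteq> 0" "Y i k \<noteq> 0" using ik(3) by auto
  obtain j l where jl: "j \<noteq> i" "l \<noteq> k"
    "\<And>u v. u \<in> U \<Longrightarrow> v \<in> V \<Longrightarrow> X u v = X i k * root_vec i j u * root_vec k l v"
    using root_vec_tensor_if_small_support[OF fin X ik(1,2) nz(1)] by metis
  obtain j' l' where jl': "j' \<noteq> i" "l' \<noteq> k"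
    "\<And>u v. u \<in> U \<Longrightarrow> v \<in> V \<Longrightarrow> Y u v = Y i k * root_vec i j' u * root_vec k l' v"
    using root_vec_tensor_if_small_support[OF fin Y ik(1,2) nz(2)] by metis
  have "X u v * Y u v \<ge> 0" if "u \<in> U" "v \<in> V" for u v
  proof -
    \<comment> \<open>Grouping by sides pairs two roots with the same positive index. Their negative
      indices differ from it, so a -1 can only meet a 0 or another -1.\<close>
    have "X u v * Y u v = (X i k * Y i k) *
        ((root_vec i j u * root_vec i j' u) * (root_vec k l v * root_vec k l' v))"
      unfolding jl(3)[OF that] jl'(3)[OF that] by (simp only: mult_ac)
    moreover have "root_vec i j u * root_vec i j' u \<ge> 0" "root_vec k l v * root_vec k l' v \<ge> 0"
      using jl(1,2) jl'(1,2) by (auto simp: root_vec_def)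
    ultimately show ?thesis using ik(3) by simp
  qed
  then have "(\<Sum>p\<in>U \<times> V. X (fst p) (snd p) * Y (fst p) (snd p)) > 0"
    by (intro sum_pos2[of _ "(i, k)"]) (use fin ik in auto)
  then show ?thesis by (simp add: sum.cartesian_product case_prod_beta)
qed

section \<open>Counting signed edges\<close>

lemma sum_if_at_most_one:
  fixes Q :: "'i \<Rightarrow> bool"
  assumes "\<And>b c. b \<in> I \<Longrightarrow> c \<in> I \<Longrightarrow> Q b \<Longrightarrow> Q c \<Longrightarrow> b = c"
  shows "(\<Sum>b\<in>I. of_bool (Q b) :: real) \<in> {0, 1}"
proof (cases "\<exists>b\<in>I. Q b")
  case True
  then obtain b where b: "b \<in> I" "Q b" by blast
  then have "(\<Sum>c\<in>I. of_bool (Q c) :: real) = (\<Sum>c\<in>I. of_bool (c = b))"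
    using assms by (intro sum.cong refl) (auto simp: of_bool_def)
  \<comment> \<open>For infinite \<open>I\<close> the sum is 0 by convention, which the claim also
    admits.\<close>
  then show ?thesis by (cases "finite I") (auto simp: of_bool_def)
next
  case False
  then have "(\<Sum>b\<in>I. of_bool (Q b) :: real) = 0" by (intro sum.neutral) auto
  then show ?thesis by simp
qed

lemma card_support_eq_sum:
  assumes "finite U" "finite V"
  shows "real (card {(u, v) \<in> U \<times> V. X u v \<noteq> 0}) =
    (\<Sum>p\<in>U \<times> V. of_bool (X (fst p) (snd p) \<noteq> 0))"
proof -
  have "{(u, v) \<in> U \<times> V. X u v \<noteq> 0} = (U \<times> V) \<inter> {p. X (fst p) (snd p) \<noteq> 0}" by auto
  then show ?thesis using assms by (simp add: of_bool_def sum.If_cases)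
qed

text \<open>Both the number of uses \<open>N\<close> of an edge and the absolute value of the sum
  \<open>S\<close> are charged to the two signed copies of that edge. A nonzero \<open>S\<close>
  adds a charge of at least 4, which exceeds the room left by the members of the family.\<close>

lemma sum_obtuse_4_cycles_eq_0:
  fixes X :: "'i \<Rightarrow> 'a \<Rightarrow> 'b \<Rightarrow> real"
  assumes fin: "finite U" "finite V"
    and size: "3 \<le> card U" "3 \<le> card V" "(card U - 1) * (card V - 1) \<le> card I"
    and zls: "\<And>b. b \<in> I \<Longrightarrow> zero_line_sums U V (X b)"
    and small: "\<And>b. b \<in> I \<Longrightarrow> card {(u, v) \<in> U \<times> V. X b u v \<noteq> 0} \<le> 4"
    and nonzero: "\<And>b. b \<in> I \<Longrightarrow> \<exists>u\<in>U. \<exists>v\<in>V. X b u v \<noteq> 0"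
    and entries: "\<And>b u v. b \<in> I \<Longrightarrow> X b u v \<in> {- 1, 0, 1}"
    and obtuse: "\<And>b c. b \<in> I \<Longrightarrow> c \<in> I \<Longrightarrow> b \<noteq> c \<Longrightarrow> (\<Sum>u\<in>U. \<Sum>v\<in>V. X b u v * X c u v) \<le> 0"
    and uv: "u \<in> U" "v \<in> V"
  shows "(\<Sum>b\<in>I. X b u v) = 0"
proof (rule ccontr)
  define S where "S u v = (\<Sum>b\<in>I. X b u v)" for u v
  define N where "N u v = (\<Sum>b\<in>I. \<bar>X b u v\<bar>)" for u v
  assume "(\<Sum>b\<in>I. X b u v) \<noteq> 0"
  then have "S u v \<noteq> 0" by (simp add: S_def)
  have agree: "b = c" if "b \<in> I" "c \<in> I" "u \<in> U" "v \<in> V" "X b u v * X c u v > 0" for b c u v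
    using inner_product_pos_if_agree[OF fin zls small zls small that(3-5)]
      obtuse[of b c] that(1,2) by fastforce
  \<comment> \<open>With \<open>P\<close> and \<open>M\<close> the numbers of entries +1 and -1,
    both 0 or 1 by \<open>agree\<close>, the left side is P + M + |P - M| = 2 max(P, M).\<close>
  have cover: "N u v + \<bar>S u v\<bar> \<le> 2" and S_abs: "S u v \<noteq> 0 \<Longrightarrow> \<bar>S u v\<bar> \<ge> 1"
    if "u \<in> U" "v \<in> V" for u v
  proof -
    define P where "P = (\<Sum>b\<in>I. of_bool (X b u v = 1) :: real)"
    define M where "M = (\<Sum>b\<in>I. of_bool (X b u v = - 1) :: real)"
    have "P \<in> {0, 1}" unfolding P_def
      by (rule sum_if_at_most_one) (use agree that in auto)
    moreover have "M \<in> {0, 1}" unfolding M_def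
      by (rule sum_if_at_most_one) (use agree that in auto)
    moreover have "S u v = P - M"
      unfolding S_def P_def M_def sum_subtractf[symmetric]
      by (rule sum.cong[OF refl]) (use entries in fastforce)
    moreover have "N u v = P + M"
      unfolding N_def P_def M_def sum.distrib[symmetric]
      by (rule sum.cong[OF refl]) (use entries in fastforce)
    ultimately show "N u v + \<bar>S u v\<bar> \<le> 2" "S u v \<noteq> 0 \<Longrightarrow> \<bar>S u v\<bar> \<ge> 1" by auto
  qed
  have "zero_line_sums U V S"
    unfolding zero_line_sums_def S_def
  proof (intro conjI ballI)
    show "(\<Sum>v\<in>V. \<Sum>b\<in>I. X b u v) = 0" if "u \<in> U" for u
      using zls that by (subst sum.swap) (auto simp: zero_line_sums_def)
    show "(\<Sum>u\<in>U. \<Sum>b\<in>I. X b u v) = 0" if "v \<in> V" for v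
      using zls that by (subst sum.swap) (auto simp: zero_line_sums_def)
  qed
  then have "4 \<le> card {(u, v) \<in> U \<times> V. S u v \<noteq> 0}"
    using card_support_ge_4[where X = S, OF fin _ uv \<open>S u v \<noteq> 0\<close>] by blast
  also have "real (card {(u, v) \<in> U \<times> V. S u v \<noteq> 0}) = 
      (\<Sum>p\<in>U \<times> V. of_bool (S (fst p) (snd p) \<noteq> 0))"
    by (rule card_support_eq_sum[OF fin])
  also have "\<dots> \<le> (\<Sum>p\<in>U \<times> V. \<bar>S (fst p) (snd p)\<bar>)"
    using S_abs by (intro sum_mono) (auto simp: of_bool_def)
  finally have S4: "4 \<le> (\<Sum>p\<in>U \<times> V. \<bar>S (fst p) (snd p)\<bar>)" by simp
  have "4 \<le> (\<Sum>p\<in>U \<times> V. \<bar>X b (fst p) (snd p)\<bar>)" if b: "b \<in> I" for b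
  proof -
    obtain i k where ik: "i \<in> U" "k \<in> V" "X b i k \<noteq> 0" using nonzero[OF b] by blast
    have "4 \<le> card {(u, v) \<in> U \<times> V. X b u v \<noteq> 0}"
      by (rule card_support_ge_4[where X = "X b", OF fin zls[OF b] ik])
    also have "real (card {(u, v) \<in> U \<times> V. X b u v \<noteq> 0}) = 
        (\<Sum>p\<in>U \<times> V. of_bool (X b (fst p) (snd p) \<noteq> 0))"
      by (rule card_support_eq_sum[OF fin])
    also have "\<dots> = (\<Sum>p\<in>U \<times> V. \<bar>X b (fst p) (snd p)\<bar>)"
    proof (rule sum.cong[OF refl])
      show "of_bool (X b (fst p) (snd p) \<noteq> 0) = \<bar>X b (fst p) (snd p)\<bar>" for p
        using entries[OF b, of "fst p" "snd p"] by auto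
    qed
    finally show ?thesis by simp
  qed
  then have "(\<Sum>b\<in>I. 4) \<le> (\<Sum>b\<in>I. \<Sum>p\<in>U \<times> V. \<bar>X b (fst p) (snd p)\<bar>)"
    by (rule sum_mono)
  also have "\<dots> = (\<Sum>p\<in>U \<times> V. N (fst p) (snd p))"
    unfolding N_def by (rule sum.swap)
  finally have N4: "4 * real (card I) \<le> (\<Sum>p\<in>U \<times> V. N (fst p) (snd p))" by simp
  have "(\<Sum>p\<in>U \<times> V. N (fst p) (snd p) + \<bar>S (fst p) (snd p)\<bar>) \<le> (\<Sum>p\<in>U \<times> V. 2)"
    using cover by (intro sum_mono) auto
  then have "4 * real (card I) + 4 \<le> 2 * (real (card U) * real (card V))"
    using N4 S4 by (simp add: sum.distrib card_cartesian_product)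
  moreover have "real ((card U - 1) * (card V - 1)) \<le> real (card I)"
    using size(3) by (rule of_nat_mono)
  then have "(real (card U) - 1) * (real (card V) - 1) \<le> real (card I)"
    using size(1,2) by (simp add: of_nat_diff)
  \<comment> \<open>With a = |U| and b = |V|, the two bounds above give 4(a - 1)(b - 1) + 4 <= 2ab,
    that is 2(a - 2)(b - 2) <= 0.\<close>
  moreover have "(real (card U) - 2) * (real (card V) - 2) \<ge> 1 * 1"
    using size(1,2) by (intro mult_mono) auto
  ultimately show False by (simp add: algebra_simps)
qed


section \<open>Rank of a lattice of functions\<close>

lemma sum_fun_apply: "(\<Sum>x\<in>T. (f x :: 'e \<Rightarrow> real)) e = (\<Sum>x\<in>T. f x e)"
  by (induction T rule: infinite_finite_induct) auto

text \<open>The separating functions form a diagonal pattern on \<open>D\<close>, so they are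
  linearly independent over the reals. The integer span lies in the real span, where the exchange
  bound for vector spaces applies.\<close>

lemma card_le_if_separated_in_int_span:
  fixes T :: "('e \<Rightarrow> real) set"
  assumes finT: "finite T"
    and sep: "\<And>d. d \<in> D \<Longrightarrow> \<exists>x\<in>int_module.span T. x d \<noteq> 0 \<and> (\<forall>e\<in>D - {d}. x e = 0)"
  shows "card D \<le> card T"
proof -
  define scale where "scale = (\<lambda>(k::real) (f :: 'e \<Rightarrow> real) e. k * f e)"
  interpret rv: vector_space scale
    by unfold_locales (auto simp: scale_def fun_eq_iff algebra_simps)
  have span: "int_module.span T \<subseteq> rv.span T"
  proof (rule int_module.span_minimal[OF rv.span_superset])
    have "int_scale k x \<in> rv.span T" if "x \<in> rv.span T" for k x
      using rv.span_scale[OF that, of "of_int k"] by (simp add: scale_def int_scale_def)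
    then show "int_module.subspace (rv.span T)"
      by (auto simp: int_module.subspace_def rv.span_zero rv.span_add)
  qed
  obtain x where x: "\<And>d. d \<in> D \<Longrightarrow> x d \<in> int_module.span T" "\<And>d. d \<in> D \<Longrightarrow> x d d \<noteq> 0"
    "\<And>d e. d \<in> D \<Longrightarrow> e \<in> D \<Longrightarrow> e \<noteq> d \<Longrightarrow> x d e = 0"
    using sep by (metis DiffI singletonD)
  have "inj_on x D"
    using x by (metis inj_onI)
  moreover have "rv.independent (x ` D)"
    unfolding rv.independent_explicit_module
  proof (intro allI impI)
    fix t u w
    assume t: "finite t" "t \<subseteq> x ` D" "(\<Sum>v\<in>t. scale (u v) v) = 0" "w \<in> t"
    then obtain d where d: "d \<in> D" "w = x d" by blast
    \<comment> \<open>Evaluation at d isolates the coefficient of w, since every other member of t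
      vanishes there.\<close>
    have "(\<Sum>v\<in>t. u v * v d) = 0"
      using fun_cong[OF t(3), of d] by (simp add: sum_fun_apply scale_def)
    also have "(\<Sum>v\<in>t. u v * v d) = (\<Sum>v\<in>{w}. u v * v d)"
      by (rule sum.mono_neutral_right) (use t d x(3) in auto)
    finally show "u w = 0" using d x(2) by simp
  qed
  moreover have "x ` D \<subseteq> rv.span T" using x(1) span by auto
  ultimately show ?thesis
    using rv.independent_span_bound[OF finT, of "x ` D"] by (simp add: card_image)
qed


section \<open>Flows on an oriented complete bipartite graph\<close>

locale oriented_bipartite =
  fixes U V :: "'v set" and A :: "('v \<times> 'v) set"
  assumes finU: "finite U" and finV: "finite V" and disj: "U \<inter> V = {}"
    and A_sub: "A \<subseteq> U \<times> V \<union> V \<times> U"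
    and A_iff: "u \<in> U \<Longrightarrow> v \<in> V \<Longrightarrow> (u, v) \<in> A \<longleftrightarrow> (v, u) \<notin> A"
begin

text \<open>By \<open>inj_arc\<close> and \<open>arc_image\<close> this is a bijection from matrix
  positions to oriented edges, turning sums over edges into double sums.\<close>

definition arc :: "'v \<times> 'v \<Rightarrow> 'v \<times> 'v" where
  "arc p = (if p \<in> A then p else prod.swap p)"

text \<open>The flow from \<open>U\<close> to \<open>V\<close> along each edge, whatever its orientation in \<open>A\<close>.\<close>

definition flow_mat :: "('v \<times> 'v \<Rightarrow> real) \<Rightarrow> 'v \<Rightarrow> 'v \<Rightarrow> real" where
  "flow_mat f u v = (if (u, v) \<in> A then f (u, v) else - f (v, u))"

text \<open>Inverse to \<open>flow_mat\<close> on the positions in U x V, extended by 0 outside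
  \<open>A\<close> as membership in \<open>integral_flows\<close> demands.\<close>

definition mat_flow :: "('v \<Rightarrow> 'v \<Rightarrow> real) \<Rightarrow> 'v \<times> 'v \<Rightarrow> real" where
  "mat_flow X e = (if e \<in> A then if fst e \<in> U then X (fst e) (snd e) else - X (snd e) (fst e) else 0)"

lemma inj_arc: "inj_on arc (U \<times> V)"
  using disj by (auto simp: inj_on_def arc_def split: if_splits)

lemma arc_image: "arc ` (U \<times> V) = A"
proof
  show "arc ` (U \<times> V) \<subseteq> A" using A_iff by (auto simp: arc_def)
  show "A \<subseteq> arc ` (U \<times> V)"
  proof
    fix e assume e: "e \<in> A"
    then consider u v where "e = (u, v)" "u \<in> U" "v \<in> V" | u v where "e = (v, u)" "u \<in> U" "v \<in> V"
      using A_sub by blast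
    then show "e \<in> arc ` (U \<times> V)"
    proof cases
      case (1 u v)
      then have "arc (u, v) = e" using e by (simp add: arc_def)
      then show ?thesis using 1 by blast
    next
      case (2 u v)
      then have "arc (u, v) = e" using e A_iff by (auto simp: arc_def)
      then show ?thesis using 2 by blast
    qed
  qed
qed

lemma sum_arcs: "(\<Sum>e\<in>A. h e) = (\<Sum>u\<in>U. \<Sum>v\<in>V. h (arc (u, v)))"
  using sum.reindex[OF inj_arc, of h] by (simp add: arc_image sum.cartesian_product)

text \<open>Reversing an edge negates both factors, so inner products do not depend on the
  orientation.\<close>

lemma sum_arcs_mult:
  "(\<Sum>e\<in>A. f e * g e) = (\<Sum>u\<in>U. \<Sum>v\<in>V. flow_mat f u v * flow_mat g u v)"
  unfolding sum_arcs by (intro sum.cong refl) (auto simp: arc_def flow_mat_def)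

lemma boundary_eq:
  "boundary A f w = (\<Sum>u\<in>U. \<Sum>v\<in>V. (of_bool (w = v) - of_bool (w = u)) * flow_mat f u v)"
  unfolding boundary_def sum_arcs using disj
  by (intro sum.cong refl) (auto simp: arc_def flow_mat_def incidence_def)

lemma boundary_left:
  assumes "w \<in> U"
  shows "boundary A f w = - (\<Sum>v\<in>V. flow_mat f w v)"
proof -
  have "boundary A f w = (\<Sum>u\<in>U. if u = w then - (\<Sum>v\<in>V. flow_mat f u v) else 0)"
    unfolding boundary_eq sum_negf[symmetric] if_distrib[of sum]
    by (intro sum.cong refl) (use assms disj in \<open>auto intro!: sum.cong sum.neutral simp: sum_negf[symmetric]\<close>)
  then show ?thesis using assms finU by simp
qed

lemma boundary_right:
  assumes "w \<in> V"
  shows "boundary A f w = (\<Sum>u\<in>U. flow_mat f u w)"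
proof -
  have "boundary A f w = (\<Sum>u\<in>U. \<Sum>v\<in>V. if v = w then flow_mat f u v else 0)"
    unfolding boundary_eq
    by (intro sum.cong refl) (use assms disj in auto)
  then show ?thesis using assms finV by simp
qed

lemma zero_line_sums_iff:
  "zero_line_sums U V (flow_mat f) \<longleftrightarrow> (\<forall>w\<in>U \<union> V. boundary A f w = 0)"
  unfolding zero_line_sums_def ball_Un by (simp add: boundary_left boundary_right)

lemma flow_mat_mat_flow: "u \<in> U \<Longrightarrow> v \<in> V \<Longrightarrow> flow_mat (mat_flow X) u v = X u v"
  using disj A_iff by (auto simp: flow_mat_def mat_flow_def)

lemma mat_flow_eq_0_iff:
  "u \<in> U \<Longrightarrow> v \<in> V \<Longrightarrow> mat_flow X (arc (u, v)) = 0 \<longleftrightarrow> X u v = 0"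
  using disj A_iff by (auto simp: arc_def mat_flow_def)

lemma card_support_flow_mat_le:
  assumes "finite A"
  shows "card {(u, v) \<in> U \<times> V. flow_mat f u v \<noteq> 0} \<le> card {e \<in> A. f e \<noteq> 0}"
proof (rule card_inj_on_le)
  show "inj_on arc {(u, v) \<in> U \<times> V. flow_mat f u v \<noteq> 0}"
    by (rule inj_on_subset[OF inj_arc]) auto
  show "arc ` {(u, v) \<in> U \<times> V. flow_mat f u v \<noteq> 0} \<subseteq> {e \<in> A. f e \<noteq> 0}"
    using A_iff by (auto simp: arc_def flow_mat_def split: if_splits)
qed (use assms in simp)

lemma finite_A: "finite A"
  using finite_imageI[of "U \<times> V" arc] finU finV by (simp add: arc_image)

lemma eq_0_if_flow_mat_eq_0:
  assumes "\<And>u v. u \<in> U \<Longrightarrow> v \<in> V \<Longrightarrow> flow_mat f u v = 0" "\<And>e. e \<notin> A \<Longrightarrow> f e = 0"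
  shows "f = 0"
proof
  fix e
  show "f e = 0 e"
  proof (cases "e \<in> A")
    case True
    then obtain u v where "u \<in> U" "v \<in> V" "e = arc (u, v)" using arc_image by blast
    then show ?thesis using assms(1)[of u v] by (auto simp: flow_mat_def arc_def split: if_splits)
  qed (use assms(2) in simp)
qed

text \<open>The edges at u0 or v0 form a spanning tree. Each of the (|U| - 1)(|V| - 1) remaining
  edges has a fundamental 4-cycle through u0 and v0, which avoids all other non-tree edges.\<close>

lemma card_basis_ge:
  assumes verts: "pverts G = U \<union> V"
    and T: "finite T" "int_module.span T = integral_flows G A"
    and ne: "U \<noteq> {}" "V \<noteq> {}"
  shows "(card U - 1) * (card V - 1) \<le> card T"
proof -
  obtain u0 v0 where 0: "u0 \<in> U" "v0 \<in> V" using ne by blast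
  define D where "D = (U - {u0}) \<times> (V - {v0})"
  have D_sub: "D \<subseteq> U \<times> V" by (auto simp: D_def)
  have "card (arc ` D) \<le> card T"
  proof (rule card_le_if_separated_in_int_span[OF T(1)])
    fix d assume "d \<in> arc ` D"
    then obtain i k where ik: "(i, k) \<in> D" "d = arc (i, k)" by auto
    \<comment> \<open>The fundamental cycle of the edge (i, k): its other three positions lie in row
      u0 or column v0, hence outside \<open>D\<close>.\<close>
    define X where "X u v = root_vec i u0 u * root_vec k v0 v" for u v
    have X: "zero_line_sums U V X"
      unfolding X_def by (rule zero_line_sums_root_vec) (use finU finV ik 0 in \<open>auto simp: D_def\<close>)
    have "zero_line_sums U V (flow_mat (mat_flow X)) \<longleftrightarrow> zero_line_sums U V X"
      unfolding zero_line_sums_def by (simp add: flow_mat_mat_flow)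
    then have "\<forall>w\<in>pverts G. boundary A (mat_flow X) w = 0"
      using X zero_line_sums_iff verts by simp
    moreover have "X u v \<in> \<int>" for u v by (auto simp: X_def root_vec_def of_bool_def)
    ultimately have "mat_flow X \<in> int_module.span T"
      unfolding T(2) by (auto simp: integral_flows_def mat_flow_def)
    moreover have "mat_flow X d \<noteq> 0"
      using ik by (auto simp: mat_flow_eq_0_iff D_def X_def root_vec_def)
    moreover have "mat_flow X e = 0" if e: "e \<in> arc ` D - {d}" for e
    proof -
      obtain u v where "(u, v) \<in> D" "e = arc (u, v)" "(u, v) \<noteq> (i, k)"
        using e ik by auto
      then show ?thesis by (auto simp: mat_flow_eq_0_iff D_def X_def root_vec_def)
    qed
    ultimately show "\<exists>x\<in>int_module.span T. x d \<noteq> 0 \<and> (\<forall>e\<in>arc ` D - {d}. x e = 0)"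
      by blast
  qed
  moreover have "card (arc ` D) = (card U - 1) * (card V - 1)"
    using card_image[OF inj_on_subset[OF inj_arc D_sub]] 0
    by (simp add: D_def card_cartesian_product)
  ultimately show ?thesis by simp
qed

end

section \<open>The contradiction for complete bipartite graphs\<close>

theorem proposition4p5:
  fixes G :: "'v pair_pre_digraph"
    and A :: "('v \<times> 'v) set"
    and B :: "('v \<times> 'v \<Rightarrow> real) list"
    and m n :: nat
  assumes "3 \<le> m" and "m \<le> n"
    and "K\<^bsub>m,n\<^esub> (with_proj G)"
    and "orientation G A"
    and "cycle_M_basis G A B"
  shows "\<exists>f\<in>set B. card {e \<in> A. f e \<noteq> 0} > 4"
proof (rule ccontr)
  assume "\<not> ?thesis"
  then have small: "card {e \<in> A. f e \<noteq> 0} \<le> 4" if "f \<in> set B" for f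
    using that by (metis not_less)
  obtain U V where UV: "finite (pverts G)" "pverts G = U \<union> V" "U \<inter> V = {}" "card U = m" "card V = n"
      "parcs G = U \<times> V \<union> V \<times> U"
    using assms(3) unfolding complete_bipartite_digraph_pair_def by blast
  interpret oriented_bipartite U V A
    using UV assms(4) by unfold_locales (auto simp: orientation_def)
  have B: "distinct B" "int_module.independent (set B)"
      "int_module.span (set B) = integral_flows G A" "Z_matrix (dual_laplacian A B)"
    and cyc: "\<And>f. f \<in> set B \<Longrightarrow> \<exists>p. f = cycle_vector A p"
    using assms(5)
    by (auto simp: cycle_M_basis_def integral_flow_M_basis_def integral_flow_basis_def M_matrix_def)
  have flow: "f \<in> integral_flows G A" if "f \<in> set B" for f
    using B(3) int_module.span_base that by blast
  then have off: "f e = 0" if "f \<in> set B" "e \<notin> A" for f e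
    using flow[OF that(1)] that(2) unfolding integral_flows_def by blast
  have "U \<noteq> {}" "V \<noteq> {}" using UV assms(1,2) by auto
  then have card_B: "(card U - 1) * (card V - 1) \<le> card (set B)"
    using card_basis_ge[OF UV(2) _ B(3)] by simp
  \<comment> \<open>Distinct basis elements sit at distinct indices, so their inner product is an
    off-diagonal entry of the dual Laplacian.\<close>
  have obtuse: "(\<Sum>u\<in>U. \<Sum>v\<in>V. flow_mat f u v * flow_mat g u v) \<le> 0"
    if fg: "f \<in> set B" "g \<in> set B" "f \<noteq> g" for f g
  proof -
    obtain i j where "i < length B" "j < length B" "f = B ! i" "g = B ! j"
      using fg by (metis in_set_conv_nth)
    then show ?thesis
      using B(4) fg(3) by (auto simp: Z_matrix_def dual_laplacian_def sum_arcs_mult)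
  qed
  \<comment> \<open>The family of matrices is indexed by the basis flows themselves.\<close>
  have sum0: "(\<Sum>f\<in>set B. flow_mat f u v) = 0" if "u \<in> U" "v \<in> V" for u v
  proof (rule sum_obtuse_4_cycles_eq_0[OF finU finV _ _ card_B _ _ _ _ obtuse that])
    show "3 \<le> card U" "3 \<le> card V" using UV assms(1,2) by auto
    fix f assume f: "f \<in> set B"
    show "zero_line_sums U V (flow_mat f)"
      using flow[OF f] UV(2) by (simp add: zero_line_sums_iff integral_flows_def)
    show "card {(u, v) \<in> U \<times> V. flow_mat f u v \<noteq> 0} \<le> 4"
      using card_support_flow_mat_le[OF finite_A] small[OF f] order_trans by blast
    show "\<exists>u\<in>U. \<exists>v\<in>V. flow_mat f u v \<noteq> 0"
    proof (rule ccontr)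
      assume "\<not> ?thesis"
      then have "f = 0" using eq_0_if_flow_mat_eq_0 off[OF f] by blast
      then show False using f B(2) int_module.dependent_zero by blast
    qed
    show "flow_mat f u v \<in> {- 1, 0, 1}" for u v
      using cyc[OF f] by (fastforce simp: flow_mat_def cycle_vector_def split: if_splits)
  qed
  have "(\<Sum>f\<in>set B. f) = 0"
  proof (rule eq_0_if_flow_mat_eq_0)
    show "flow_mat (\<Sum>f\<in>set B. f) u v = 0" if "u \<in> U" "v \<in> V" for u v
      using sum0[OF that] by (auto simp: flow_mat_def sum_fun_apply sum_negf)
    show "(\<Sum>f\<in>set B. f) e = 0" if "e \<notin> A" for e
      unfolding sum_fun_apply using that off by (intro sum.neutral) blast
  qed
  \<comment> \<open>The vanishing sum is an integer relation with all coefficients 1, so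
    independence leaves only an empty basis. The rank bound (m - 1)(n - 1) > 0 excludes
    that.\<close>
  then have "(\<Sum>f\<in>set B. int_scale 1 f) = 0" by (simp add: int_scale_def)
  then have "(1 :: int) = 0" if "f \<in> set B" for f
    using B(2)[unfolded int_module.independent_explicit_module, rule_format,
        of "set B" "\<lambda>_. 1" f] that by simp
  then have "set B = {}" by (metis equals0I one_neq_zero)
  then have "(card U - 1) * (card V - 1) = 0" using card_B by simp
  then show False using UV(4,5) assms(1,2) by auto
qed

end
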